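(* Let $r\ge 5$ be an integer. Then (a) $F_v(2_r;r-2)\ge r+9$; (b) $F_v(2_r;r-2)=r+9$ if $r\ge 8$.
   Context: All graphs are finite, undirected, without loops or multiple edges. For a graph $G$, $\omega(G)$ denotes the clique number. For positive integers $a_1,\dots,a_r$, $G\to^v(a_1,\dots,a_r)$ means that for every partition $V(G)=V_1\cup\dots\cup V_r$ into pairwise disjoint (possibly empty) sets there is an $i$ such that $V_i$ contains an $a_i$-clique. Write $(2_r)$ for the $r$-tuple $(2,\dots,2)$; thus $G\to^v(2_r)$ is equivalent to $\chi(G)\ge r+1$. For an integer $q$, $H_v(2_r;q)$ is the set of graphs $G$ with $G\to^v(2_r)$ and $\omega(G)<q$, and $F_v(2_r;q)=\min\{|V(G)|: G\in H_v(2_r;q)\}$ (it exists whenever $q\ge 3$). *)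

theory Defs
  imports "HOL-Library.Ramsey" "HOL-Library.Disjoint_Sets"
begin

text \<open>A graph is a pair of a vertex set and a set of edges, each edge being a two-element set
  of vertices. Cliques are those of \<^theory>\<open>HOL-Library.Ramsey\<close>.\<close>

definition fin_graph :: "'a set \<times> 'a set set \<Rightarrow> bool" where
  "fin_graph = (\<lambda>(V, E). finite V \<and> E \<subseteq> [V]\<^bsup>2\<^esup>)"

definition clique_number :: "'a set \<times> 'a set set \<Rightarrow> nat" where
  "clique_number = (\<lambda>(V, E). Max {card K | K. K \<subseteq> V \<and> clique K E})"

definition arrows_v :: "'a set \<times> 'a set set \<Rightarrow> nat list \<Rightarrow> bool" where
  "arrows_v = (\<lambda>(V, E) as. \<forall>W :: nat \<Rightarrow> 'a set.
     (\<Union>i<length as. W i) = V \<and> disjoint_family_on W {..<length as} \<longrightarrow>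
     (\<exists>i<length as. \<exists>K\<subseteq>W i. card K = as ! i \<and> clique K E))"

definition H_v :: "nat list \<Rightarrow> nat \<Rightarrow> ('a set \<times> 'a set set) set" where
  "H_v as q = {G. fin_graph G \<and> arrows_v G as \<and> clique_number G < q}"

text \<open>The minimum ranges over graphs whose vertices are natural numbers; every finite graph is
  isomorphic to one of these. If there is no such graph, the infimum is 0, so a positive lower
  bound on \<open>F_v\<close> includes the existence of a suitable graph.\<close>

definition F_v :: "nat list \<Rightarrow> nat \<Rightarrow> nat" where
  "F_v as q = Inf {card V | V E. (V :: nat set, E) \<in> H_v as q}"

end

theory Submission
  imports Defs "HOL-Library.Nat_Bijection"
begin

text \<open>If \<open>\<chi>(G) = k + 1\<close> and \<open>G\<close> has at most \<open>k + 2d + 2\<close> vertices for some \<open>d \<le> 3\<close>, then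
  \<open>\<omega>(G) \<ge> k + 1 - d\<close>; the lower bound is the case \<open>k = r\<close>, \<open>d = 3\<close>. Deleting an independent triple
  lowers \<open>\<chi>\<close> by at most one and passes from \<open>(k, d)\<close> to \<open>(k - 1, d - 1)\<close>, so assume there is none.
  Then the complement \<open>H\<close> is triangle-free, \<open>\<chi>(G) \<le> |V| - \<nu>(H)\<close>, so \<open>\<nu>(H) \<le> 2d + 1 \<le> 7\<close>, and one
  needs \<open>\<alpha>(H) \<ge> |V| - \<nu> - \<lfloor>\<nu> / 2\<rfloor>\<close>. This inequality survives adding a vertex that
  lies in every maximum matching, and disjoint unions. By Gallai's lemma the remaining case is
  \<open>|V| \<le> 2 \<nu> + 1\<close>, where \<open>R(3,k) \<le> k(k + 1) / 2\<close> is enough.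

  Equality for \<open>r \<ge> 8\<close> is attained by the join of a clique with the complement of a graph on 17
  vertices that witnesses \<open>R(3,6) > 17\<close>. Shift graphs show that the minimum is over a nonempty set
  for \<open>r < 8\<close> too.\<close>

section \<open>Matchings in triangle-free graphs\<close>

definition matching :: "'a set \<Rightarrow> 'a set set \<Rightarrow> 'a set set \<Rightarrow> bool" where
  "matching U F M \<longleftrightarrow> M \<subseteq> F \<inter> [U]\<^bsup>2\<^esup> \<and> pairwise disjnt M"

lemma matching_finite: "matching U F M \<Longrightarrow> finite U \<Longrightarrow> finite M"
  unfolding matching_def by (meson finite_imp_finite_nsets finite_subset le_inf_iff)

lemma matching_Union_subset: "matching U F M \<Longrightarrow> \<Union>M \<subseteq> U"
  unfolding matching_def nsets_def by blast

lemma matching_mono: "matching U F M \<Longrightarrow> U \<subseteq> U' \<Longrightarrow> matching U' F M"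
  unfolding matching_def nsets_def by blast

lemma matching_insert:
  assumes "matching U F M" "{x, y} \<in> F" "x \<in> U" "y \<in> U" "x \<noteq> y" "x \<notin> \<Union>M" "y \<notin> \<Union>M"
  shows "matching U F (insert {x, y} M)"
  using assms unfolding matching_def by (auto simp: pairwise_insert disjnt_def)

lemma matching_card_Union:
  assumes "matching U F M" "finite U"
  shows "card (\<Union>M) = 2 * card M"
proof -
  have "card (\<Union>M) = sum card M"
    using assms by (intro card_Union_disjoint) (auto simp: matching_def nsets_def)
  also have "\<dots> = sum (\<lambda>_. 2) M"
    using assms by (intro sum.cong) (auto simp: matching_def nsets_def)
  finally show ?thesis by simp
qed

text \<open>When \<open>M\<close> and \<open>N\<close> are maximum matchings, this is Gallai's exchange argument. The conclusion
  allows a larger matching so that the induction, which deletes both ends of an edge of \<open>M\<close>, need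
  not keep track of maximality.\<close>

lemma matching_exchange:
  assumes "finite M" "finite N" "pairwise disjnt M" "pairwise disjnt N"
    and "\<And>e. e \<in> M \<union> N \<Longrightarrow> card e = 2" "card M = card N"
    and "u \<noteq> w" "u \<notin> \<Union>M" "w \<notin> \<Union>M" "v \<notin> \<Union>N"
  shows "\<exists>L\<subseteq>M \<union> N. pairwise disjnt L \<and>
    (card L = Suc (card M) \<or> card L = card M \<and> v \<notin> \<Union>L \<and> (u \<notin> \<Union>L \<or> w \<notin> \<Union>L))"
  using assms
proof (induction "card M" arbitrary: M N v)
  case 0
  then show ?case by (intro exI[of _ M]) auto
next
  case (Suc n)
  show ?case
  proof (cases "v \<in> \<Union>M")
    case False
    then show ?thesis using Suc.prems by (intro exI[of _ M]) auto
  next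
    case True
    then obtain e where e: "e \<in> M" "v \<in> e" by auto
    have "card e = 2" using Suc.prems(5) e by auto
    then obtain v1 where v1: "e = {v, v1}" "v1 \<noteq> v"
      using e(2) by (auto simp: card_2_iff)
    \<comment> \<open>Follow the alternating path from \<open>v\<close>: along \<open>e\<close> in
      \<open>M\<close> to \<open>v1\<close>, then along an edge of \<open>N\<close> to
      \<open>v2\<close>. If \<open>N\<close> misses \<open>v1\<close>, adding \<open>e\<close> to
      \<open>N\<close> gives a larger matching.\<close>
    show ?thesis
    proof (cases "v1 \<in> \<Union>N")
      case False
      have "e \<notin> N" using e(2) Suc.prems(10) by auto
      moreover have "pairwise disjnt (insert e N)"
        using Suc.prems(4,10) False v1 by (auto simp: pairwise_insert disjnt_def)
      ultimately show ?thesis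
        using e Suc.prems by (intro exI[of _ "insert e N"]) auto
    next
      case True
      then obtain f where f: "f \<in> N" "v1 \<in> f" by auto
      have "card f = 2" using Suc.prems(5) f by auto
      then obtain v2 where v2: "f = {v1, v2}" "v2 \<noteq> v1"
        using f(2) by (auto simp: card_2_iff)
      have v2v: "v2 \<noteq> v" using Suc.prems(10) f v2 by auto
      define M1 where "M1 = M - {e}"
      define N1 where "N1 = N - {f}"
      have M1: "v \<notin> \<Union>M1" "v1 \<notin> \<Union>M1"
        using pairwiseD[OF Suc.prems(3) e(1)] v1 unfolding M1_def disjnt_def by auto
      have N1: "v1 \<notin> \<Union>N1" "v2 \<notin> \<Union>N1" "v \<notin> \<Union>N1"
        using pairwiseD[OF Suc.prems(4) f(1)] Suc.prems(10) v2 unfolding N1_def disjnt_def by auto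
      have cM1: "n = card M1" and cN1: "card M1 = card N1"
        using Suc.hyps(2) Suc.prems(1,2,6) e(1) f(1) by (simp_all add: M1_def N1_def)
      have dM1: "pairwise disjnt M1" and dN1: "pairwise disjnt N1"
        using Suc.prems(3,4) unfolding M1_def N1_def by (auto intro: pairwise_subset)
      have fin: "finite M1" "finite N1"
        using Suc.prems(1,2) unfolding M1_def N1_def by auto
      have v1M: "v1 \<in> \<Union>M" using e v1 by auto
      show ?thesis
      proof (cases "v2 \<in> \<Union>M")
        case False
        \<comment> \<open>Exchanging \<open>e\<close> for \<open>f\<close> in \<open>M\<close> frees
          \<open>v\<close>; \<open>f\<close> can meet only one of \<open>u\<close> and
          \<open>w\<close>, since \<open>v1\<close> is covered by \<open>M\<close>.\<close>
        have "pairwise disjnt (insert f M1)"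
          using dM1 M1 False v2 by (auto simp: pairwise_insert disjnt_def M1_def)
        moreover have "f \<notin> M1" using M1 f by auto
        moreover have "v \<notin> \<Union>(insert f M1)" using M1 v1(2) v2 v2v by auto
        moreover have "u \<notin> \<Union>(insert f M1) \<or> w \<notin> \<Union>(insert f M1)"
          using Suc.prems(7-9) v1M v2 unfolding M1_def by auto
        moreover have "insert f M1 \<subseteq> M \<union> N" using f by (auto simp: M1_def)
        ultimately show ?thesis
          using cM1 Suc.hyps(2) fin by (intro exI[of _ "insert f M1"]) auto
      next
        case True
        \<comment> \<open>Now \<open>v2\<close>, missed by \<open>N1\<close>, takes the place of
          \<open>v\<close>. The resulting \<open>L\<close> avoids \<open>v\<close> and
          \<open>v1\<close>, so \<open>e\<close> can be added if \<open>L\<close> is larger, and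
          otherwise \<open>f\<close>, which keeps \<open>v\<close> free.\<close>
        have "\<exists>L\<subseteq>M1 \<union> N1. pairwise disjnt L \<and> (card L = Suc (card M1) \<or>
            card L = card M1 \<and> v2 \<notin> \<Union>L \<and> (u \<notin> \<Union>L \<or> w \<notin> \<Union>L))"
          by (rule Suc.hyps(1)[OF cM1 fin dM1 dN1 _ cN1 Suc.prems(7)])
            (use Suc.prems(5,8,9) N1 in \<open>auto simp: M1_def N1_def\<close>)
        then obtain L where L: "L \<subseteq> M1 \<union> N1" "pairwise disjnt L"
          and alt: "card L = Suc (card M1) \<or>
            card L = card M1 \<and> v2 \<notin> \<Union>L \<and> (u \<notin> \<Union>L \<or> w \<notin> \<Union>L)"
          by blast
        have vL: "v \<notin> \<Union>L" "v1 \<notin> \<Union>L" using L(1) M1 N1 by auto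
        have finL: "finite L" using L(1) fin finite_subset by blast
        have LMN: "L \<subseteq> M \<union> N" using L(1) unfolding M1_def N1_def by auto
        from alt show ?thesis
        proof
          assume c: "card L = Suc (card M1)"
          have "pairwise disjnt (insert e L)"
            using L(2) vL v1 by (auto simp: pairwise_insert disjnt_def)
          moreover have "e \<notin> L" using vL e by auto
          ultimately show ?thesis
            using c cM1 Suc.hyps(2) finL LMN e(1) by (intro exI[of _ "insert e L"]) auto
        next
          assume "card L = card M1 \<and> v2 \<notin> \<Union>L \<and> (u \<notin> \<Union>L \<or> w \<notin> \<Union>L)"
          then have c: "card L = card M1" "v2 \<notin> \<Union>L" and uw: "u \<notin> \<Union>L \<or> w \<notin> \<Union>L"
            by auto
          have "pairwise disjnt (insert f L)"
            using L(2) vL c v2 by (auto simp: pairwise_insert disjnt_def)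
          moreover have "f \<notin> L" using vL f by auto
          moreover have "v \<notin> \<Union>(insert f L)" using vL v1(2) v2 v2v by auto
          moreover have "u \<notin> f" "w \<notin> f" using True v1M Suc.prems(8,9) v2 by auto
          ultimately show ?thesis
            using c cM1 Suc.hyps(2) finL LMN f(1) uw by (intro exI[of _ "insert f L"]) auto
        qed
      qed
    qed
  qed
qed

section \<open>Independent sets in triangle-free graphs\<close>

text \<open>Neighbourhoods in a triangle-free graph are independent, so a vertex with at least
  \<open>k + 1\<close> neighbours settles the step to \<open>k + 1\<close>. Otherwise deleting a
  vertex and its neighbours costs at most \<open>k + 1\<close> vertices, the difference of
  consecutive triangular numbers.\<close>

lemma triangle_free_indep:
  assumes "finite U" "\<And>T. T \<subseteq> U \<Longrightarrow> card T = 3 \<Longrightarrow> \<not> clique T F"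
    and "k * (k + 1) \<le> 2 * card U"
  shows "\<exists>I\<subseteq>U. indep I F \<and> card I = k"
  using assms
proof (induction k arbitrary: U)
  case 0
  then show ?case by (intro exI[of _ "{}"]) auto
next
  case (Suc k)
  then have "U \<noteq> {}" by auto
  then obtain v where v: "v \<in> U" by auto
  define D where "D = {x \<in> U. x \<noteq> v \<and> {v, x} \<in> F}"
  have finD: "finite D" and DU: "D \<subseteq> U" using Suc.prems(1) by (auto simp: D_def)
  have iD: "indep D F"
    unfolding indep_def
  proof (intro ballI impI notI)
    fix x y assume xy: "x \<in> D" "y \<in> D" "x \<noteq> y" "{x, y} \<in> F"
    then have "card {v, x, y} = 3" "{v, x, y} \<subseteq> U" "clique {v, x, y} F"
      using v by (auto simp: D_def clique_def insert_commute)
    then show False using Suc.prems(2) by blast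
  qed
  show ?case
  proof (cases "card D \<ge> Suc k")
    case True
    then obtain I where "I \<subseteq> D" "card I = Suc k"
      by (meson obtain_subset_with_card_n)
    then show ?thesis using iD smaller_indep DU by blast
  next
    case False
    have "v \<notin> D" by (simp add: D_def)
    then have "card (insert v D) = Suc (card D)" using finD by simp
    moreover have "card (U - insert v D) = card U - card (insert v D)"
      using finD v DU by (intro card_Diff_subset) auto
    ultimately have "card U \<le> card (U - insert v D) + Suc k" using False by simp
    then have "k * (k + 1) \<le> 2 * card (U - insert v D)"
      using Suc.prems(3) by simp
    then obtain I where I: "I \<subseteq> U - insert v D" "indep I F" "card I = k"
      using Suc.IH[of "U - insert v D"] Suc.prems(1,2) by (meson Diff_subset finite_Diff subset_trans)
    have "finite I" using I(1) Suc.prems(1) finite_subset by blast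
    moreover have "v \<notin> I" using I(1) by auto
    moreover have "indep (insert v I) F"
      using I v unfolding indep_def D_def by (auto simp: insert_commute)
    ultimately show ?thesis
      using I v by (intro exI[of _ "insert v I"]) auto
  qed
qed

text \<open>Supplies the size hypothesis of \<open>triangle_free_indep\<close> when a matching of
  \<open>m\<close> edges misses at most one vertex. Equality holds for \<open>m = 7\<close>,
  \<open>n = 15\<close>.\<close>

lemma ramsey_arith:
  assumes "m \<le> 7" "n \<le> 2 * m + 1"
  shows "(n - m - m div 2) * ((n - m - m div 2) + 1) \<le> 2 * (n::nat)"
proof -
  have "\<forall>m\<in>set [0..<8]. \<forall>n\<in>set [0..<2 * m + 2].
      (n - m - m div 2) * ((n - m - m div 2) + 1) \<le> 2 * n"
    by code_simp
  moreover have "m \<in> set [0..<8]" "n \<in> set [0..<2 * m + 2]" using assms by auto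
  ultimately show ?thesis by blast
qed

text \<open>The matching in the conclusion need not be maximum, so for disjoint unions the matchings
  and independent sets of the parts can simply be united.\<close>

lemma triangle_free_matching_indep:
  assumes "finite U" "\<And>T. T \<subseteq> U \<Longrightarrow> card T = 3 \<Longrightarrow> \<not> clique T F"
    and "\<And>M. matching U F M \<Longrightarrow> card M \<le> 7"
  shows "\<exists>M I. matching U F M \<and> I \<subseteq> U \<and> indep I F \<and> card U \<le> card I + card M + card M div 2"
  using assms
proof (induction "card U" arbitrary: U rule: less_induct)
  case less
  have IH: "\<exists>M I. matching W F M \<and> I \<subseteq> W \<and> indep I F \<and> card W \<le> card I + card M + card M div 2"
    if "W \<subset> U" for W
    using that less.prems matching_mono[of W F _ U]
    by (intro less.hyps) (auto intro: psubset_card_mono finite_subset)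
  define mx where
    "mx M \<longleftrightarrow> matching U F M \<and> (\<forall>M'. matching U F M' \<longrightarrow> card M' \<le> card M)" for M
  have "matching U F {}" by (simp add: matching_def)
  then have "\<exists>M. matching U F M \<and> (\<forall>M'. matching U F M' \<longrightarrow> card M' \<le> card M)"
    by (rule ex_has_greatest_nat[where b=8]) (use less.prems(3) in force)
  then obtain M where M: "mx M" unfolding mx_def by blast
  show ?case
  proof (cases "\<exists>v\<in>U. \<forall>N. mx N \<longrightarrow> v \<in> \<Union>N")
    case True
    then obtain v where v: "v \<in> U" "\<And>N. mx N \<Longrightarrow> v \<in> \<Union>N" by blast
    then obtain M' I where M': "matching (U - {v}) F M'" "I \<subseteq> U - {v}" "indep I F"
      and le: "card (U - {v}) \<le> card I + card M' + card M' div 2"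
      using IH[of "U - {v}"] by blast
    \<comment> \<open>A matching that avoids \<open>v\<close> is not maximum, so passing to
      \<open>M\<close> gains an edge, which pays for \<open>v\<close>.\<close>
    have "matching U F M'" using M'(1) matching_mono by blast
    moreover have "v \<notin> \<Union>M'" using M'(1) matching_Union_subset by blast
    ultimately have "card M' < card M"
      using v(2)[of M'] M unfolding mx_def by (meson leI le_trans)
    moreover have "card U = Suc (card (U - {v}))"
      using v(1) less.prems(1) by (metis card_Suc_Diff1)
    moreover have "card M' div 2 \<le> card M div 2" using calculation(1) by simp
    ultimately have "card U \<le> card I + card M + card M div 2"
      using le by linarith
    then show ?thesis using M M' unfolding mx_def by blast
  next
    case False
    \<comment> \<open>Gallai's relation: its classes are the connected components.\<close>
    define R where "R u v \<longleftrightarrow> u = v \<or> (\<forall>N. mx N \<longrightarrow> u \<in> \<Union>N \<or> v \<in> \<Union>N)" for u v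
    have trans: "R u w" if uv: "R u v" and vw: "R v w" and v: "v \<in> U" for u v w
    proof (rule ccontr)
      assume nR: "\<not> R u w"
      then obtain A where A: "mx A" "u \<notin> \<Union>A" "w \<notin> \<Union>A" and uw: "u \<noteq> w"
        unfolding R_def by blast
      obtain B where B: "mx B" "v \<notin> \<Union>B" using False v by blast
      have cAB: "card A = card B" using A B unfolding mx_def by (meson le_antisym)
      have uvw: "u \<noteq> v" "v \<noteq> w" using nR uv vw by auto
      \<comment> \<open>A maximum matching that misses \<open>v\<close> and one of \<open>u\<close>,
        \<open>w\<close> contradicts \<open>R u v\<close> or \<open>R v w\<close>.\<close>
      have "\<exists>L\<subseteq>A \<union> B. pairwise disjnt L \<and> (card L = Suc (card A) \<or>
          card L = card A \<and> v \<notin> \<Union>L \<and> (u \<notin> \<Union>L \<or> w \<notin> \<Union>L))"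
      proof (rule matching_exchange)
        have mAB: "matching U F A" "matching U F B" using A(1) B(1) unfolding mx_def by simp_all
        then show "finite A" "finite B" using less.prems(1) matching_finite by metis+
        show "pairwise disjnt A" "pairwise disjnt B" using mAB unfolding matching_def by simp_all
        show "card e = 2" if "e \<in> A \<union> B" for e
          using mAB that unfolding matching_def nsets_def by blast
      qed (use A B cAB uw in auto)
      then obtain L where L: "L \<subseteq> A \<union> B" "pairwise disjnt L"
        and alt: "card L = Suc (card A) \<or> card L = card A \<and> v \<notin> \<Union>L \<and> (u \<notin> \<Union>L \<or> w \<notin> \<Union>L)"
        by blast
      have mL: "matching U F L" using L A B unfolding mx_def matching_def by blast
      then have "card L \<le> card A" using A unfolding mx_def by blast
      then have eq: "card L = card A" "v \<notin> \<Union>L" "u \<notin> \<Union>L \<or> w \<notin> \<Union>L" using alt by auto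
      then have "mx L" using mL A(1) unfolding mx_def by simp
      then show False using eq uv vw uvw unfolding R_def by blast
    qed
    have adj: "R u v" if "{u, v} \<in> F" "u \<in> U" "v \<in> U" for u v
    proof (rule ccontr)
      assume "\<not> R u v"
      then obtain A where A: "mx A" "u \<notin> \<Union>A" "v \<notin> \<Union>A" "u \<noteq> v"
        unfolding R_def by blast
      then have "matching U F (insert {u, v} A)"
        using that unfolding mx_def by (intro matching_insert) auto
      moreover have "card (insert {u, v} A) = Suc (card A)"
        using A less.prems(1) matching_finite unfolding mx_def by (subst card_insert_disjoint) blast+
      ultimately show False using A(1) unfolding mx_def by fastforce
    qed
    show ?thesis
    proof (cases "\<forall>u\<in>U. \<forall>v\<in>U. R u v")
      case True
      \<comment> \<open>With a single class no maximum matching misses two vertices.\<close>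
      have "card (U - \<Union>M) \<le> 1"
      proof -
        have "x = y" if "x \<in> U - \<Union>M" "y \<in> U - \<Union>M" for x y
          using True M that unfolding R_def by blast
        then show ?thesis using less.prems(1) by (simp add: card_le_Suc0_iff_eq)
      qed
      moreover have "card (U - \<Union>M) = card U - 2 * card M"
        using M less.prems(1) matching_Union_subset matching_card_Union finite_subset
        unfolding mx_def by (metis card_Diff_subset)
      ultimately have n: "card U \<le> 2 * card M + 1" by linarith
      have m: "card M \<le> 7" using M less.prems(3) unfolding mx_def by blast
      obtain I where "I \<subseteq> U" "indep I F" "card I = card U - card M - card M div 2"
        using triangle_free_indep[OF less.prems(1,2) ramsey_arith[OF m n]] by blast
      then show ?thesis
        using M unfolding mx_def by (intro exI[of _ M] exI[of _ I]) auto
    next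
      case False
      then obtain v where v: "v \<in> U" "\<exists>x\<in>U. \<not> R v x" by blast
      \<comment> \<open>By \<open>adj\<close>, edges lie inside classes: \<open>C\<close> and
        \<open>D\<close> are proper subsets of \<open>U\<close> with no edge between them.\<close>
      define C where "C = {x \<in> U. R v x}"
      define D where "D = U - C"
      have "v \<in> C" using v by (simp add: C_def R_def)
      then have "C \<subset> U" "D \<subset> U" using v unfolding C_def D_def by blast+
      then obtain M1 I1 M2 I2 where 1: "matching C F M1" "I1 \<subseteq> C" "indep I1 F"
          "card C \<le> card I1 + card M1 + card M1 div 2"
        and 2: "matching D F M2" "I2 \<subseteq> D" "indep I2 F"
          "card D \<le> card I2 + card M2 + card M2 div 2"
        using IH by meson
      have CD: "{x, y} \<notin> F" if "x \<in> C" "y \<in> D" for x y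
        using that adj[of x y] trans[of v x y] unfolding C_def D_def by blast
      have finC: "finite C" "finite D" using less.prems(1) unfolding C_def D_def by auto
      have dCD: "C \<inter> D = {}" "C \<union> D = U" using \<open>C \<subset> U\<close> unfolding D_def by auto
      have U: "\<Union>M1 \<subseteq> C" "\<Union>M2 \<subseteq> D" using 1 2 matching_Union_subset by metis+
      have "matching U F (M1 \<union> M2)"
        unfolding matching_def
      proof
        have "matching U F M1" "matching U F M2"
          using 1(1) 2(1) matching_mono dCD by blast+
        then show "M1 \<union> M2 \<subseteq> F \<inter> [U]\<^bsup>2\<^esup>" unfolding matching_def by blast
        show "pairwise disjnt (M1 \<union> M2)"
        proof (rule pairwiseI)
          fix e f assume ef: "e \<in> M1 \<union> M2" "f \<in> M1 \<union> M2" "e \<noteq> f"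
          have "pairwise disjnt M1" "pairwise disjnt M2"
            using 1(1) 2(1) unfolding matching_def by simp_all
          moreover have "disjnt g h" if "g \<in> M1" "h \<in> M2" for g h
            using that U dCD(1) unfolding disjnt_def by blast
          ultimately show "disjnt e f"
            using ef by (metis Un_iff disjnt_sym pairwiseD)
        qed
      qed
      moreover have "indep (I1 \<union> I2) F"
        unfolding indep_def
      proof (intro ballI impI)
        fix x y assume "x \<in> I1 \<union> I2" "y \<in> I1 \<union> I2" "x \<noteq> y"
        then show "{x, y} \<notin> F"
          using 1(2,3) 2(2,3) CD[of x y] CD[of y x] unfolding indep_def
          by (auto simp: insert_commute)
      qed
      moreover have "card (M1 \<union> M2) = card M1 + card M2"
      proof (rule card_Un_disjoint)
        show "finite M1" "finite M2" using 1 2 finC matching_finite by metis+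
        have "e \<noteq> {}" if "e \<in> M1" for e using that 1(1) unfolding matching_def nsets_def by auto
        then show "M1 \<inter> M2 = {}" using U dCD by blast
      qed
      moreover have "card (I1 \<union> I2) = card I1 + card I2"
        using 1(2) 2(2) finC dCD by (intro card_Un_disjoint) (auto intro: finite_subset)
      moreover have "card U = card C + card D"
        using dCD finC card_Un_disjoint by metis
      moreover have "I1 \<union> I2 \<subseteq> U" using 1 2 dCD by blast
      \<comment> \<open>The two bounds add up because
        \<open>a div 2 + b div 2 \<le> (a + b) div 2\<close>.\<close>
      ultimately show ?thesis
        using 1(4) 2(4) by (intro exI[of _ "M1 \<union> M2"] exI[of _ "I1 \<union> I2"]) auto
    qed
  qed
qed

section \<open>The lower bound\<close>

text \<open>This is colourability with \<open>k\<close> colours. Classes may overlap, which is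
  harmless because subsets of independent sets are independent.\<close>

definition indep_cover :: "'a set set \<Rightarrow> 'a set \<Rightarrow> nat \<Rightarrow> bool" where
  "indep_cover E U k \<longleftrightarrow> (\<exists>P. finite P \<and> card P \<le> k \<and> \<Union>P = U \<and> (\<forall>A\<in>P. indep A E))"

lemma indep_cover_mono: "indep_cover E U k \<Longrightarrow> k \<le> l \<Longrightarrow> indep_cover E U l"
  unfolding indep_cover_def using le_trans by blast

lemma indep_cover_insert:
  assumes "indep_cover E (U - A) k" "A \<subseteq> U" "indep A E"
  shows "indep_cover E U (Suc k)"
proof -
  obtain P where P: "finite P" "card P \<le> k" "\<Union>P = U - A" "\<forall>A\<in>P. indep A E"
    using assms(1) unfolding indep_cover_def by blast
  then have "card (insert A P) \<le> Suc k" using card_insert_le_m1 by (simp add: card_insert_if)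
  then show ?thesis
    using P assms unfolding indep_cover_def by (intro exI[of _ "insert A P"]) auto
qed

text \<open>The pairs in \<open>M\<close> are non-edges of \<open>E\<close>, so each can serve as
  one colour class and saves one of the \<open>card U\<close> colours.\<close>

lemma indep_cover_matching:
  assumes "finite U" "matching U (- E) M"
  shows "indep_cover E U (card U - card M)"
proof -
  define P where "P = M \<union> (\<lambda>x. {x}) ` (U - \<Union>M)"
  have sub: "\<Union>M \<subseteq> U" using assms(2) matching_Union_subset by blast
  have fin: "finite M" using assms matching_finite by blast
  have "card (U - \<Union>M) = card U - 2 * card M"
    using sub assms matching_card_Union finite_subset by (metis card_Diff_subset)
  moreover have "2 * card M \<le> card U"
    using matching_card_Union[OF assms(2,1)] card_mono[OF assms(1) sub] by simp
  moreover have "card P \<le> card M + card (U - \<Union>M)"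
    unfolding P_def using assms(1)
    by (meson add_left_mono card_Un_le card_image_le finite_Diff le_trans)
  ultimately have "card P \<le> card U - card M" by linarith
  moreover have "indep A E" if "A \<in> P" for A
  proof (cases "A \<in> M")
    case True
    then have "A \<in> - E" "card A = 2" using assms(2) unfolding matching_def nsets_def by auto
    then show ?thesis by (auto simp: card_2_iff indep_def insert_commute)
  next
    case False
    then show ?thesis using that by (auto simp: P_def indep_def)
  qed
  moreover have "finite P" "\<Union>P = U" using assms(1) fin sub unfolding P_def by auto
  ultimately show ?thesis unfolding indep_cover_def by blast
qed

text \<open>Without independent triples the complement \<open>- E\<close> is triangle-free. Its
  matchings are small, since every matched pair saves a colour, so it has a large independent set,
  which is a clique of \<open>E\<close>.\<close>

lemma clique_if_no_indep_triple:
  assumes "finite U" "d \<le> 3" "card U \<le> k + 2 * d + 2" "\<not> indep_cover E U k"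
    and "\<nexists>A. A \<subseteq> U \<and> card A = 3 \<and> indep A E"
  shows "\<exists>K\<subseteq>U. clique K E \<and> k + 1 \<le> card K + d"
proof -
  have compl: "clique T (- E) \<longleftrightarrow> indep T E" "indep T (- E) \<longleftrightarrow> clique T E" for T
    by (auto simp: clique_def indep_def)
  have m: "card M + k < card U" if "matching U (- E) M" for M
    using indep_cover_matching[OF assms(1) that] assms(4) indep_cover_mono
    by (metis not_le less_diff_conv add.commute)
  have "card M \<le> 7" if "matching U (- E) M" for M
    using m[OF that] assms(2,3) by linarith
  moreover have "\<not> clique T (- E)" if "T \<subseteq> U" "card T = 3" for T
    using that assms(5) compl by blast
  ultimately obtain M I where MI: "matching U (- E) M" "I \<subseteq> U" "indep I (- E)"
      "card U \<le> card I + card M + card M div 2"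
    using triangle_free_matching_indep[OF assms(1)] by metis
  \<comment> \<open>Matchings have at most \<open>2 * d + 1\<close> edges, and this odd bound still
    halves to \<open>d\<close>.\<close>
  have "card M div 2 \<le> d" using m[OF MI(1)] assms(3) by linarith
  then have "k + 1 \<le> card I + d" using m[OF MI(1)] MI(4) by linarith
  then show ?thesis using MI compl by blast
qed

lemma clique_if_not_indep_cover:
  assumes "finite U" "d \<le> 3" "card U \<le> k + 2 * d + 2" "\<not> indep_cover E U k"
  shows "\<exists>K\<subseteq>U. clique K E \<and> k + 1 \<le> card K + d"
  using assms
proof (induction d arbitrary: U k)
  case 0
  show ?case
  proof (cases "\<exists>A. A \<subseteq> U \<and> card A = 3 \<and> indep A E")
    case True
    then obtain A where A: "A \<subseteq> U" "card A = 3" "indep A E" by blast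
    have "finite A" using A 0 finite_subset by blast
    then have c: "card (U - A) + 3 = card U"
      using A card_mono[OF 0(1) A(1)] by (simp add: card_Diff_subset)
    \<comment> \<open>For \<open>d = 0\<close>, the triple as one class and singletons elsewhere use
      \<open>card U - 2 \<le> k\<close> colours.\<close>
    have "indep_cover E (U - A) (card (U - A))"
      using indep_cover_matching[of "U - A" E "{}"] 0(1) by (simp add: matching_def)
    then have "indep_cover E U (Suc (card (U - A)))" using A indep_cover_insert by blast
    then have "indep_cover E U k" by (rule indep_cover_mono) (use c 0(3) in simp)
    then show ?thesis using 0(4) by blast
  next
    case False
    then show ?thesis using clique_if_no_indep_triple[OF 0(1-4)] by blast
  qed
next
  case (Suc d)
  show ?case
  proof (cases "\<exists>A. A \<subseteq> U \<and> card A = 3 \<and> indep A E")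
    case True
    then obtain A where A: "A \<subseteq> U" "card A = 3" "indep A E" by blast
    have "finite A" using A Suc finite_subset by blast
    then have c: "card (U - A) + 3 = card U"
      using A card_mono[OF Suc.prems(1) A(1)] by (simp add: card_Diff_subset)
    show ?thesis
    proof (cases k)
      case 0
      obtain a where "a \<in> A" using A(2) by fastforce
      then show ?thesis using A(1) 0 by (intro exI[of _ "{a}"]) (auto simp: clique_def)
    next
      case (Suc l)
      have "\<not> indep_cover E (U - A) l"
        using Suc.prems(4) A indep_cover_insert \<open>k = Suc l\<close> by blast
      \<comment> \<open>Three vertices are lost while \<open>k\<close> and \<open>d\<close> each
        drop by one, so \<open>k + 2 * d + 2\<close> also drops by three.\<close>
      moreover have "card (U - A) \<le> l + 2 * d + 2" using c Suc.prems(3) \<open>k = Suc l\<close> by simp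
      ultimately obtain K where "K \<subseteq> U - A" "clique K E" "l + 1 \<le> card K + d"
        using Suc.IH[of "U - A" l] Suc.prems by auto
      then show ?thesis using \<open>k = Suc l\<close> by (intro exI[of _ K]) auto
    qed
  next
    case False
    then show ?thesis using clique_if_no_indep_triple[OF Suc.prems] by blast
  qed
qed

section \<open>Arrowing and clique number in terms of covers and cliques\<close>

lemma arrows_v_iff_not_indep_cover:
  "arrows_v (V, E) (replicate r 2) \<longleftrightarrow> \<not> indep_cover E V r"
proof
  assume arr: "arrows_v (V, E) (replicate r 2)"
  show "\<not> indep_cover E V r"
  proof
    assume "indep_cover E V r"
    then obtain P where P: "finite P" "card P \<le> r" "\<Union>P = V" "\<forall>A\<in>P. indep A E"
      unfolding indep_cover_def by blast
    obtain xs where xs: "set xs = P" "distinct xs" using P(1) finite_distinct_list by blast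
    have len: "length xs \<le> r" using xs P(2) distinct_card by fastforce
    \<comment> \<open>Empty sets pad the cover to exactly \<open>r\<close> classes;
      \<open>disjointed\<close> then turns it into a partition with the same union.\<close>
    define A where "A i = (if i < length xs then xs ! i else {})" for i
    have iA: "indep (A i) E" for i using P(4) xs(1) unfolding A_def by auto
    have "(\<Union>i<r. A i) = V"
      using len P(3) unfolding xs(1)[symmetric] A_def by (auto simp: set_conv_nth split: if_splits) force
    then have "(\<Union>i<r. disjointed A i) = V"
      using finite_UN_disjointed_eq[of A r] by (simp add: lessThan_atLeast0)
    moreover have "disjoint_family_on (disjointed A) {..<r}"
      by (meson disjoint_family_disjointed disjoint_family_on_mono subset_UNIV)
    ultimately have "\<exists>i<r. \<exists>K\<subseteq>disjointed A i. card K = replicate r 2 ! i \<and> clique K E"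
      using arr unfolding arrows_v_def by simp
    then obtain i K where K: "i < r" "K \<subseteq> disjointed A i" "card K = 2" "clique K E"
      by auto
    then have "indep K E" using iA disjointed_subset smaller_indep by metis
    then show False using K(3,4) by (auto simp: card_2_iff clique_def indep_def)
  qed
next
  assume nc: "\<not> indep_cover E V r"
  show "arrows_v (V, E) (replicate r 2)"
    unfolding arrows_v_def
  proof (simp, intro allI impI, elim conjE)
    fix W :: "nat \<Rightarrow> 'a set"
    assume W: "(\<Union>i<r. W i) = V"
    show "\<exists>i<r. \<exists>K\<subseteq>W i. card K = replicate r 2 ! i \<and> clique K E"
    proof (rule ccontr)
      assume no: "\<not> ?thesis"
      have "indep (W i) E" if "i < r" for i
        unfolding indep_def
      proof (intro ballI impI notI)
        fix x y assume xy: "x \<in> W i" "y \<in> W i" "x \<noteq> y" "{x, y} \<in> E"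
        then have "{x, y} \<subseteq> W i" "card {x, y} = 2" "clique {x, y} E"
          by (auto simp: clique_def insert_commute)
        then show False using no that by fastforce
      qed
      moreover have "card (W ` {..<r}) \<le> r" using card_image_le[of "{..<r}" W] by simp
      ultimately have "indep_cover E V r"
        using W unfolding indep_cover_def by (intro exI[of _ "W ` {..<r}"]) auto
      then show False using nc by blast
    qed
  qed
qed

lemma clique_number_less_iff:
  assumes "finite V"
  shows "clique_number (V, E) < q \<longleftrightarrow> (\<forall>K\<subseteq>V. clique K E \<longrightarrow> card K < q)"
proof -
  have "{card K |K. K \<subseteq> V \<and> clique K E} \<subseteq> card ` Pow V" by auto
  then have "finite {card K |K. K \<subseteq> V \<and> clique K E}" using assms finite_subset by blast
  moreover have "{card K |K. K \<subseteq> V \<and> clique K E} \<noteq> {}" using null_clique by blast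
  ultimately show ?thesis unfolding clique_number_def by (auto simp: Max_less_iff)
qed

lemma H_v_replicate_2_iff:
  "(V, E) \<in> H_v (replicate r 2) q \<longleftrightarrow>
    finite V \<and> E \<subseteq> [V]\<^bsup>2\<^esup> \<and> \<not> indep_cover E V r \<and> (\<forall>K\<subseteq>V. clique K E \<longrightarrow> card K < q)"
  unfolding H_v_def fin_graph_def
  using clique_number_less_iff[of V E q] arrows_v_iff_not_indep_cover[of V E r] by auto

lemma H_v_card_ge:
  assumes "(V, E) \<in> H_v (replicate r 2) (r - 2)"
  shows "r + 9 \<le> card V"
proof (rule ccontr)
  assume "\<not> r + 9 \<le> card V"
  \<comment> \<open>At most \<open>r + 8 = r + 2 * 3 + 2\<close> vertices is the case
    \<open>d = 3\<close>.\<close>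
  then obtain K where K: "K \<subseteq> V" "clique K E" "r + 1 \<le> card K + 3"
    using clique_if_not_indep_cover[of V 3 r E] assms unfolding H_v_replicate_2_iff by auto
  then have "card K < r - 2" using assms unfolding H_v_replicate_2_iff by blast
  then show False using K(3) by linarith
qed

section \<open>Shift graphs\<close>

text \<open>The pairs are encoded as numbers because \<open>F_v\<close> ranges over graphs on
  \<open>nat\<close>.\<close>

definition shift_vertices :: "nat \<Rightarrow> nat set" where
  "shift_vertices n = prod_encode ` {(i, j). i < j \<and> j < n}"

definition shift_edges :: "nat \<Rightarrow> nat set set" where
  "shift_edges n = {{prod_encode (i, j), prod_encode (j, k)} | i j k. i < j \<and> j < k \<and> k < n}"

lemma finite_shift_vertices: "finite (shift_vertices n)"
  unfolding shift_vertices_def by (rule finite_imageI) (rule finite_subset[of _ "{..<n} \<times> {..<n}"], auto)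

lemma shift_edges_subset: "shift_edges n \<subseteq> [shift_vertices n]\<^bsup>2\<^esup>"
  unfolding shift_edges_def shift_vertices_def by (auto simp: prod_encode_eq)

lemma shift_edges_iff:
  "{prod_encode (a, b), prod_encode (c, d)} \<in> shift_edges n \<longleftrightarrow>
    a < b \<and> c < d \<and> (b = c \<and> d < n \<or> d = a \<and> b < n)"
  unfolding shift_edges_def by (auto simp: doubleton_eq_iff prod_encode_eq)

text \<open>Of three pairwise adjacent pairs, the one with the least first entry ends where both
  others begin; but adjacent pairs have distinct first entries.\<close>

lemma shift_clique_card:
  assumes "K \<subseteq> shift_vertices n" "clique K (shift_edges n)"
  shows "card K < 3"
proof (rule ccontr)
  assume "\<not> card K < 3"
  then obtain T where T: "T \<subseteq> K" "card T = 3" by (meson not_less obtain_subset_with_card_n)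
  then obtain x y z where xyz: "T = {x, y, z}" "x \<noteq> y" "x \<noteq> z" "y \<noteq> z"
    by (auto simp: card_3_iff)
  obtain a b where x: "x = prod_encode (a, b)" by (metis prod_decode_inverse surj_pair)
  obtain c d where y: "y = prod_encode (c, d)" by (metis prod_decode_inverse surj_pair)
  obtain e f where z: "z = prod_encode (e, f)" by (metis prod_decode_inverse surj_pair)
  have "{x, y} \<in> shift_edges n" "{x, z} \<in> shift_edges n" "{y, z} \<in> shift_edges n"
    using assms(2) T(1) xyz by (auto simp: clique_def)
  then show False unfolding x y z shift_edges_iff by linarith
qed

text \<open>If \<open>i < j\<close> had the same set of colours on the pairs starting there, the
  colour of \<open>(i, j)\<close> would recur on some adjacent \<open>(j, k)\<close>. So
  \<open>n\<close> distinct subsets of \<open>r\<close> colours would be needed.\<close>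

lemma shift_not_indep_cover:
  assumes "2 ^ r < n"
  shows "\<not> indep_cover (shift_edges n) (shift_vertices n) r"
proof
  assume "indep_cover (shift_edges n) (shift_vertices n) r"
  then obtain P where P: "finite P" "card P \<le> r" "\<Union>P = shift_vertices n"
      "\<And>A. A \<in> P \<Longrightarrow> indep A (shift_edges n)"
    unfolding indep_cover_def by blast
  \<comment> \<open>\<open>S i\<close> is the set of colours on the pairs starting at \<open>i\<close>; distinct \<open>i\<close> need distinct sets.\<close>
  define S where "S i = {A \<in> P. \<exists>k<n. i < k \<and> prod_encode (i, k) \<in> A}" for i
  have neq: "S i \<noteq> S j" if "i < j" "j < n" for i j
  proof
    assume eq: "S i = S j"
    have "prod_encode (i, j) \<in> \<Union>P" using that P(3) by (auto simp: shift_vertices_def)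
    then obtain A where A: "A \<in> P" "prod_encode (i, j) \<in> A" by blast
    then have "A \<in> S i" unfolding S_def using that by blast
    then have "A \<in> S j" by (simp only: eq)
    then obtain k where k: "k < n" "j < k" "prod_encode (j, k) \<in> A" unfolding S_def by blast
    have "prod_encode (i, j) \<noteq> prod_encode (j, k)" using that by (simp add: prod_encode_eq)
    moreover have "{prod_encode (i, j), prod_encode (j, k)} \<in> shift_edges n"
      using that k by (simp add: shift_edges_iff)
    ultimately show False using P(4)[OF A(1)] A(2) k(3) unfolding indep_def by blast
  qed
  have "inj_on S {..<n}"
    by (rule linorder_inj_onI') (use neq in auto)
  moreover have "S ` {..<n} \<subseteq> Pow P" unfolding S_def by auto
  ultimately have "n \<le> card (Pow P)"
    using P(1) card_inj_on_le[of S "{..<n}" "Pow P"] by simp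
  also have "\<dots> \<le> 2 ^ r" using P(1,2) by (simp add: card_Pow)
  finally show False using assms by simp
qed

lemma H_v_nonempty:
  assumes "3 \<le> q"
  shows "\<exists>V E. (V :: nat set, E) \<in> H_v (replicate r 2) q"
proof (intro exI)
  show "(shift_vertices (2 ^ r + 1), shift_edges (2 ^ r + 1)) \<in> H_v (replicate r 2) q"
    unfolding H_v_replicate_2_iff
    using finite_shift_vertices shift_edges_subset shift_not_indep_cover[of r "2 ^ r + 1"]
      shift_clique_card assms by (meson less_add_one less_le_trans)
qed

section \<open>Attaining the bound\<close>

text \<open>Adjacency lists of a triangle-free graph on 17 vertices without independent 6-set, witnessing
  \<open>R(3,6) > 17\<close>. It has the automorphism of order 4 that rotates each of the blocks \<open>4b, \<dots>, 4b + 3\<close>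
  for \<open>b < 4\<close> and fixes 16.\<close>

definition ramsey_3_6_nbrs :: "nat list list" where
  "ramsey_3_6_nbrs =
    [[4, 5, 9, 12, 16], [5, 6, 10, 13, 16], [6, 7, 11, 14, 16], [4, 7, 8, 15, 16],
     [0, 3, 6, 11, 14], [0, 1, 7, 8, 15], [1, 2, 4, 9, 12], [2, 3, 5, 10, 13],
     [3, 5, 12, 13, 14], [0, 6, 13, 14, 15], [1, 7, 12, 14, 15], [2, 4, 12, 13, 15],
     [0, 6, 8, 10, 11], [1, 7, 8, 9, 11], [2, 4, 8, 9, 10], [3, 5, 9, 10, 11],
     [0, 1, 2, 3]]"

abbreviation ramsey_3_6_adj :: "nat \<Rightarrow> nat \<Rightarrow> bool" where
  "ramsey_3_6_adj x y \<equiv> y \<in> set (ramsey_3_6_nbrs ! x)"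

text \<open>An executable branching search: the first vertex is either taken, which discards its
  listed neighbours and lowers the budget, or skipped. On a sorted list only larger neighbours
  matter.\<close>

fun indep_at_most :: "(nat \<Rightarrow> nat list) \<Rightarrow> nat list \<Rightarrow> nat \<Rightarrow> bool" where
  "indep_at_most N [] k = True"
| "indep_at_most N (x # xs) 0 = False"
| "indep_at_most N (x # xs) (Suc k) =
    (indep_at_most N (filter (\<lambda>y. y \<notin> set (N x)) xs) k \<and> indep_at_most N xs (Suc k))"

lemma indep_at_most_card:
  assumes "indep_at_most N xs k" "sorted_wrt (<) xs" "S \<subseteq> set xs"
    and "\<And>x y. x \<in> S \<Longrightarrow> y \<in> S \<Longrightarrow> x < y \<Longrightarrow> y \<notin> set (N x)"
  shows "card S \<le> k"
  using assms
proof (induction N xs k arbitrary: S rule: indep_at_most.induct)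
  case (3 N x xs k)
  show ?case
  proof (cases "x \<in> S")
    case True
    have "card (S - {x}) \<le> k"
      using "3.prems" True by (intro "3.IH"(1)) (auto simp: sorted_wrt_filter)
    moreover have "finite S" using "3.prems"(3) finite_subset by blast
    ultimately show ?thesis using True by (simp add: card_Diff_singleton_if)
  next
    case False
    then show ?thesis using "3.prems" by (intro "3.IH"(2)) auto
  qed
qed simp_all

lemma ramsey_3_6_indep:
  assumes "S \<subseteq> {..<17}" "\<And>x y. x \<in> S \<Longrightarrow> y \<in> S \<Longrightarrow> x < y \<Longrightarrow> \<not> ramsey_3_6_adj x y"
  shows "card S \<le> 5"
proof (rule indep_at_most_card)
  show "indep_at_most (\<lambda>x. ramsey_3_6_nbrs ! x) [0..<17] 5"
    by code_simp
  show "S \<subseteq> set [0..<17]" using assms(1) by auto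
qed (use assms in auto)

lemma ramsey_3_6_triangle_free:
  assumes "x < 17" "ramsey_3_6_adj x y" "ramsey_3_6_adj x z"
  shows "\<not> ramsey_3_6_adj y z"
proof -
  have "\<forall>x\<in>set [0..<17]. \<forall>y\<in>set (ramsey_3_6_nbrs ! x). \<forall>z\<in>set (ramsey_3_6_nbrs ! x).
      z \<notin> set (ramsey_3_6_nbrs ! y)"
    by code_simp
  moreover have "x \<in> set [0..<17]" using assms(1) by simp
  ultimately show ?thesis using assms(2,3) by blast
qed

text \<open>The vertices from 17 on are universal: the lists describe non-edges.\<close>

definition cone_edges :: "nat \<Rightarrow> nat set set" where
  "cone_edges n = {{x, y} | x y. x < y \<and> y < n \<and> (y < 17 \<longrightarrow> \<not> ramsey_3_6_adj x y)}"

lemma cone_edges_iff: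
  "x < y \<Longrightarrow> {x, y} \<in> cone_edges n \<longleftrightarrow> y < n \<and> (y < 17 \<longrightarrow> \<not> ramsey_3_6_adj x y)"
  unfolding cone_edges_def by (auto simp: doubleton_eq_iff)

text \<open>Three such vertices would form a triangle in the listed graph.\<close>

lemma cone_indep_card:
  assumes "indep A (cone_edges n)" "A \<subseteq> {..<17}" "17 \<le> n"
  shows "card A \<le> 2"
proof (rule ccontr)
  assume "\<not> card A \<le> 2"
  then have "3 \<le> card A" by simp
  then obtain T where T: "T \<subseteq> A" "card T = 3" by (meson obtain_subset_with_card_n)
  have adj: "ramsey_3_6_adj x y" if "x \<in> A" "y \<in> A" "x < y" for x y
  proof -
    have "y < 17" using that assms(2) by blast
    moreover have "{x, y} \<notin> cone_edges n"
      using assms(1) that unfolding indep_def by (metis nat_neq_iff)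
    ultimately show ?thesis using that(3) assms(3) by (simp add: cone_edges_iff)
  qed
  obtain x y z where "T = {x, y, z}" "x < y" "y < z"
  proof -
    have "T \<in> [UNIV]\<^bsup>3\<^esup>" using T(2) by (simp add: nsets_def card_ge_0_finite)
    then show ?thesis using that unfolding ordered_nsets_3_eq by blast
  qed
  then show False
    using T(1) adj[of x y] adj[of x z] adj[of y z] ramsey_3_6_triangle_free[of x y z] assms(2)
    by auto
qed

text \<open>The first 17 vertices need at least 9 classes of size at most 2, and each of the
  \<open>r - 8\<close> universal vertices needs its own, \<open>r + 1\<close> in all. Cliques have
  at most \<open>5 + (r - 8) = r - 3\<close> vertices.\<close>

lemma cone_in_H_v:
  assumes "8 \<le> r"
  shows "({..<r + 9}, cone_edges (r + 9)) \<in> H_v (replicate r 2) (r - 2)"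
  unfolding H_v_replicate_2_iff
proof (intro conjI allI impI)
  show "cone_edges (r + 9) \<subseteq> [{..<r + 9}]\<^bsup>2\<^esup>"
    unfolding cone_edges_def by auto
  show "\<not> indep_cover (cone_edges (r + 9)) {..<r + 9} r"
  proof
    assume "indep_cover (cone_edges (r + 9)) {..<r + 9} r"
    then obtain P where P: "finite P" "card P \<le> r" "\<Union>P = {..<r + 9}"
        "\<And>A. A \<in> P \<Longrightarrow> indep A (cone_edges (r + 9))"
      unfolding indep_cover_def by blast
    have apex: "x = y" if "A \<in> P" "x \<in> A" "y \<in> A" "17 \<le> y" for A x y
    proof (rule ccontr)
      assume "x \<noteq> y"
      have "x < r + 9" "y < r + 9" using P(3) that by blast+
      then have "{x, y} \<in> cone_edges (r + 9)"
        using \<open>x \<noteq> y\<close> that(4) cone_edges_iff[of x y] cone_edges_iff[of y x]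
        by (cases "x < y") (auto simp: insert_commute)
      then show False using P(4)[OF that(1)] that \<open>x \<noteq> y\<close> unfolding indep_def by blast
    qed
    \<comment> \<open>By \<open>apex\<close>, every class outside \<open>Q\<close> is a single
      universal vertex, so \<open>Q\<close> must cover the first 17 vertices alone.\<close>
    define Q where "Q = {A \<in> P. A \<subseteq> {..<17}}"
    have Q: "finite Q" "Q \<subseteq> P" using P(1) unfolding Q_def by auto
    have "{..<17} \<subseteq> \<Union>Q"
    proof
      fix x :: nat assume "x \<in> {..<17}"
      then have x: "x < 17" "x \<in> \<Union>P" unfolding P(3) using assms by auto
      then obtain A where A: "A \<in> P" "x \<in> A" by blast
      then have "A \<subseteq> {..<17}" using apex[OF A] x(1) by fastforce
      then show "x \<in> \<Union>Q" using A unfolding Q_def by blast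
    qed
    then have "card {..<17::nat} \<le> card (\<Union>Q)"
      using Q(1) by (intro card_mono) (auto simp: Q_def intro: finite_subset)
    also have "\<dots> \<le> (\<Sum>A\<in>Q. card A)" by (rule card_Union_le_sum_card)
    also have "\<dots> \<le> (\<Sum>A\<in>Q. 2)"
    proof (rule sum_mono)
      fix A assume "A \<in> Q"
      then show "card A \<le> 2"
        using cone_indep_card[of A "r + 9"] P(4) assms unfolding Q_def by simp
    qed
    finally have cQ: "9 \<le> card Q" by simp
    have "{17..<r + 9} \<subseteq> \<Union>(P - Q)"
    proof
      fix x assume x: "x \<in> {17..<r + 9}"
      then have "x \<in> \<Union>P" unfolding P(3) by auto
      then obtain A where A: "A \<in> P" "x \<in> A" by blast
      then have "A \<notin> Q" using x unfolding Q_def by auto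
      then show "x \<in> \<Union>(P - Q)" using A by blast
    qed
    moreover have "finite (\<Union>(P - Q))"
      by (rule finite_subset[of _ "{..<r + 9}"]) (use P(3) in blast, simp)
    ultimately have "card {17..<r + 9} \<le> card (\<Union>(P - Q))" by (intro card_mono)
    also have "\<dots> \<le> (\<Sum>A\<in>P - Q. card A)" by (rule card_Union_le_sum_card)
    also have "\<dots> \<le> (\<Sum>A\<in>P - Q. 1)"
    proof (rule sum_mono)
      fix A assume A: "A \<in> P - Q"
      then obtain y where "y \<in> A" "17 \<le> y" unfolding Q_def by fastforce
      then have "A \<subseteq> {y}" using apex A by blast
      then show "card A \<le> 1" using card_mono[of "{y}" A] by simp
    qed
    finally have "r \<le> card (P - Q) + 8" by simp
    moreover have "card P = card Q + card (P - Q)"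
      using P(1) Q by (metis card_Diff_subset card_mono le_add_diff_inverse)
    ultimately show False using P(2) cQ by linarith
  qed
  show "card K < r - 2" if K: "K \<subseteq> {..<r + 9}" "clique K (cone_edges (r + 9))" for K
  proof -
    have "card (K \<inter> {..<17}) \<le> 5"
    proof (rule ramsey_3_6_indep)
      fix x y assume "x \<in> K \<inter> {..<17}" "y \<in> K \<inter> {..<17}" "x < y"
      then show "\<not> ramsey_3_6_adj x y"
        using K(2) cone_edges_iff[of x y "r + 9"] unfolding clique_def by auto
    qed auto
    moreover have "card (K - {..<17}) \<le> card {17..<r + 9}"
      using K(1) by (intro card_mono) auto
    moreover have "finite K" using K(1) finite_subset by blast
    then have "card K = card (K \<inter> {..<17}) + card (K - {..<17})"
      using card_Int_Diff by blast
    ultimately show ?thesis using assms by simp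
  qed
qed auto

theorem theorem1p6:
  fixes r :: nat
  assumes "r \<ge> 5"
  shows "F_v (replicate r 2) (r - 2) \<ge> r + 9 \<and>
         (r \<ge> 8 \<longrightarrow> F_v (replicate r 2) (r - 2) = r + 9)"
proof -
  let ?S = "{card V | V E. (V :: nat set, E) \<in> H_v (replicate r 2) (r - 2)}"
  \<comment> \<open>On \<open>nat\<close> the infimum of the empty set is 0, so a lower bound needs
    a member; \<open>r \<ge> 5\<close> gives \<open>r - 2 \<ge> 3\<close>, as the triangle-free
    shift graphs require.\<close>
  have "?S \<noteq> {}" using H_v_nonempty[of "r - 2" r] assms by auto
  then have lower: "r + 9 \<le> F_v (replicate r 2) (r - 2)"
    unfolding F_v_def by (rule cInf_greatest) (use H_v_card_ge in blast)
  moreover have "F_v (replicate r 2) (r - 2) \<le> r + 9" if "r \<ge> 8"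
  proof -
    have "card {..<r + 9} \<in> ?S" using cone_in_H_v[OF that] by blast
    then show ?thesis unfolding F_v_def by (intro cInf_lower) auto
  qed
  ultimately show ?thesis by (meson le_antisym)
qed

end
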